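(* Let $E,F$ be locally convex spaces, $U$ an open neighborhood of $0$ in $E$, and suppose $f:U\to F$ is uniformly continuous. Let $U_1$ be a symmetric open neighborhood of $0$ in $E$ such that $U_1+U_1\subseteq U$. Then $f(U_1^*\cap E_{\mathrm{pns}})\subseteq F_f$. In particular, if $E$ is an (HM)-space, then $f|_{U_1}$ is a finite function.
   Context: We work in a sufficiently saturated nonstandard extension; $A^*$ is the nonstandard extension of $A$, and the extension of a function is denoted by the same symbol. A locally convex space is a real Hausdorff topological vector space with a base of convex neighborhoods of $0$. $E_f=\{x\in E^* : p(x)$ is a finite hyperreal for all continuous seminorms $p$ on $E\}$, and similarly $F_f$. A point $x\in E^*$ is pre-nearstandard if for every neighborhood $V$ of $0$ in $E$ there is $y\in E$ with $x-y\in V^*$; $E_{\mathrm{pns}}$ is the set of pre-nearstandard points (always $E_{\mathrm{pns}}\subseteq E_f$). An (HM)-space is a locally convex space $E$ with $E_{\mathrm{pns}}=E_f$. For an open neighborhood $O$ of $0$ in $E$, a function $g:O\to F$ is a finite function if $g(O^*\cap E_f)\subseteq F_f$. *)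

theory Defs
  imports "HOL-Analysis.Analysis"
begin

unbundle cardinal_syntax

section \<open>Locally convex spaces\<close>

text \<open>The library has no class of topological vector spaces. The superclass
  \<^class>\<open>uniform_topological_group_add\<close> equips the additive group with its canonical
  uniformity, which is determined by the topology:
  \<open>uniformity = filtercomap (\<lambda>(x, y). y - x) (nhds 0)\<close>. Hence \<^const>\<open>uniformly_continuous_on\<close>
  is uniform continuity in the sense of topological vector spaces, and nothing is assumed
  beyond a Hausdorff locally convex vector topology.\<close>

class locally_convex_space = real_vector + uniform_topological_group_add + t2_space +
  assumes tendsto_scaleR_Pair:
      "filterlim (\<lambda>z. fst z *\<^sub>R snd z) (nhds (c *\<^sub>R a)) (nhds (c::real) \<times>\<^sub>F nhds a)"
    and convex_nbhd_base_unfolded: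
      "open W \<Longrightarrow> 0 \<in> W \<Longrightarrow> \<exists>V. (\<exists>T. open T \<and> 0 \<in> T \<and> T \<subseteq> V) \<and> V \<subseteq> W \<and>
         (\<forall>x\<in>V. \<forall>y\<in>V. \<forall>u\<ge>0. \<forall>v\<ge>0. u + v = 1 \<longrightarrow> u *\<^sub>R x + v *\<^sub>R y \<in> V)"

text \<open>The library constants \<^const>\<open>convex\<close> and \<^const>\<open>interior\<close> cannot occur in the class
  axioms, where sort constraints are not available; the axiom above is this statement:\<close>

lemma convex_nbhd_base:
  fixes W :: "'a::locally_convex_space set"
  assumes "open W" and "0 \<in> W"
  shows "\<exists>V. convex V \<and> 0 \<in> interior V \<and> V \<subseteq> W"
  using convex_nbhd_base_unfolded[OF assms] unfolding convex_def interior_def by blast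

definition seminorm :: "('a::real_vector \<Rightarrow> real) \<Rightarrow> bool" where
  "seminorm p \<longleftrightarrow> (\<forall>x y. p (x + y) \<le> p x + p y) \<and> (\<forall>c x. p (c *\<^sub>R x) = \<bar>c\<bar> * p x)"

definition nbhd_base_0 :: "'a::{topological_space,zero} set set \<Rightarrow> bool" where
  "nbhd_base_0 \<B> \<longleftrightarrow> (\<forall>B\<in>\<B>. 0 \<in> interior B) \<and> (\<forall>V. 0 \<in> interior V \<longrightarrow> (\<exists>B\<in>\<B>. B \<subseteq> V))"


section \<open>Nonstandard extensions\<close>

text \<open>A nonstandard extension of a standard universe \<open>'u\<close> with nonstandard universe \<open>'v\<close> is
  a map \<open>N\<close> that assigns to each relation \<open>R\<close> on \<open>'u\<close> (of any arity, coded as a set of lists)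
  its extension \<open>N R\<close> on \<open>'v\<close>, subject to the transfer principle for all first-order
  formulas in the language that has a symbol for every relation on \<open>'u\<close>. Variables are natural
  numbers. A standard element \<open>u\<close> is definable through the relation \<open>{[u]}\<close>, so no constant
  symbols are needed; likewise functions enter through their graphs.

  The type \<open>'u\<close> is arbitrary: the spaces and the reals are embedded in it, and it may contain
  further objects such as the sets in a level of a superstructure. So the notion
  covers the extensions given by superstructures as well as those given by ultrapowers.\<close>

datatype 'u formula =
    Rel "'u list set" "nat list"
  | Eq nat nat
  | Neg "'u formula"
  | Conj "'u formula" "'u formula"
  | All nat "'u formula"

primrec sat :: "('u list set \<Rightarrow> 'v list set) \<Rightarrow> (nat \<Rightarrow> 'v) \<Rightarrow> 'u formula \<Rightarrow> bool" where
  "sat I s (Rel R xs) \<longleftrightarrow> map s xs \<in> I R"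
| "sat I s (Eq x y) \<longleftrightarrow> s x = s y"
| "sat I s (Neg \<phi>) \<longleftrightarrow> \<not> sat I s \<phi>"
| "sat I s (Conj \<phi> \<psi>) \<longleftrightarrow> sat I s \<phi> \<and> sat I s \<psi>"
| "sat I s (All x \<phi>) \<longleftrightarrow> (\<forall>a. sat I (s(x := a)) \<phi>)"

text \<open>Quantifying over all assignments takes the universal closure of \<open>\<phi>\<close>, so this is
  transfer for sentences.\<close>

definition nonstandard_extension :: "('u list set \<Rightarrow> 'v list set) \<Rightarrow> bool" where
  "nonstandard_extension N \<longleftrightarrow>
     (\<forall>\<phi>. (\<forall>s :: nat \<Rightarrow> 'u. sat (\<lambda>R. R) s \<phi>) \<longleftrightarrow> (\<forall>s :: nat \<Rightarrow> 'v. sat N s \<phi>))"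

text \<open>Internal sets are the sections of extended relations at tuples \<open>cs\<close> of parameters
  from the nonstandard universe.\<close>

definition internal :: "('u list set \<Rightarrow> 'v list set) \<Rightarrow> 'v set \<Rightarrow> bool" where
  "internal N A \<longleftrightarrow> (\<exists>R cs. A = {x. x # cs \<in> N R})"

definition saturated :: "'k rel \<Rightarrow> ('u list set \<Rightarrow> 'v list set) \<Rightarrow> bool" where
  "saturated \<kappa> N \<longleftrightarrow>
     (\<forall>\<A>. (\<forall>A\<in>\<A>. internal N A) \<and> |\<A>| <o \<kappa> \<and> (\<forall>\<F>\<subseteq>\<A>. finite \<F> \<longrightarrow> \<Inter>\<F> \<noteq> {})
        \<longrightarrow> \<Inter>\<A> \<noteq> {})"

text \<open>Below, \<open>j\<close> and \<open>k\<close> are embeddings of standard types into the standard universe.\<close>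

definition star_elem :: "('u list set \<Rightarrow> 'v list set) \<Rightarrow> ('a \<Rightarrow> 'u) \<Rightarrow> 'a \<Rightarrow> 'v" where
  "star_elem N j a = (THE x. [x] \<in> N {[j a]})"

definition star_set :: "('u list set \<Rightarrow> 'v list set) \<Rightarrow> ('a \<Rightarrow> 'u) \<Rightarrow> 'a set \<Rightarrow> 'v set" where
  "star_set N j A = {x. [x] \<in> N {[j a] |a. a \<in> A}}"

definition star_fun ::
  "('u list set \<Rightarrow> 'v list set) \<Rightarrow> ('a \<Rightarrow> 'u) \<Rightarrow> ('b \<Rightarrow> 'u) \<Rightarrow> 'a set \<Rightarrow> ('a \<Rightarrow> 'b) \<Rightarrow> 'v \<Rightarrow> 'v" where
  "star_fun N j k A f x = (THE y. [x, y] \<in> N {[j a, k (f a)] |a. a \<in> A})"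

definition star_diff ::
  "('u list set \<Rightarrow> 'v list set) \<Rightarrow> ('a::minus \<Rightarrow> 'u) \<Rightarrow> 'v \<Rightarrow> 'v \<Rightarrow> 'v" where
  "star_diff N j x y = (THE z. [x, y, z] \<in> N {[j a, j b, j (a - b)] |a b. True})"

definition finite_hyperreal :: "('u list set \<Rightarrow> 'v list set) \<Rightarrow> (real \<Rightarrow> 'u) \<Rightarrow> 'v \<Rightarrow> bool" where
  "finite_hyperreal N jR r \<longleftrightarrow> r \<in> star_set N jR UNIV \<and>
     (\<exists>M::real. [r, star_elem N jR M] \<in> N {[jR a, jR b] |a b. \<bar>a\<bar> \<le> b})"


section \<open>Finite and pre-nearstandard points\<close>

definition fin_points ::
  "('u list set \<Rightarrow> 'v list set) \<Rightarrow> ('a::locally_convex_space \<Rightarrow> 'u) \<Rightarrow> (real \<Rightarrow> 'u) \<Rightarrow> 'v set" where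
  "fin_points N j jR = {x \<in> star_set N j UNIV.
     \<forall>p. seminorm p \<and> continuous_on UNIV p \<longrightarrow> finite_hyperreal N jR (star_fun N j jR UNIV p x)}"

definition pns_points ::
  "('u list set \<Rightarrow> 'v list set) \<Rightarrow> ('a::locally_convex_space \<Rightarrow> 'u) \<Rightarrow> 'v set" where
  "pns_points N j = {x \<in> star_set N j UNIV.
     \<forall>V. 0 \<in> interior V \<longrightarrow> (\<exists>y. star_diff N j x (star_elem N j y) \<in> star_set N j V)}"

definition HM_space ::
  "('u list set \<Rightarrow> 'v list set) \<Rightarrow> ('a::locally_convex_space \<Rightarrow> 'u) \<Rightarrow> (real \<Rightarrow> 'u) \<Rightarrow> bool" where
  "HM_space N j jR \<longleftrightarrow> pns_points N j = fin_points N j jR"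

definition finite_function ::
  "('u list set \<Rightarrow> 'v list set) \<Rightarrow> ('a::locally_convex_space \<Rightarrow> 'u) \<Rightarrow>
   ('b::locally_convex_space \<Rightarrow> 'u) \<Rightarrow> (real \<Rightarrow> 'u) \<Rightarrow> 'a set \<Rightarrow> ('a \<Rightarrow> 'b) \<Rightarrow> bool" where
  "finite_function N j k jR D g \<longleftrightarrow>
     star_fun N j k D g ` (star_set N j D \<inter> fin_points N j jR) \<subseteq> fin_points N k jR"

end

theory Submission
  imports Defs
begin

text \<open>
  Let \<open>x\<close> be a pre-nearstandard point of \<open>U\<^sub>1\<^sup>*\<close> and \<open>p\<close> a continuous seminorm on the target.
  Uniform continuity gives a neighbourhood \<open>W\<close> of \<open>0\<close> such that \<open>p \<circ> f\<close> grows by at most \<open>1\<close>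
  between two points of \<open>U\<close> whose difference lies in \<open>W\<close>. Choose a standard \<open>y\<close> with
  \<open>x - y \<in> (W \<inter> U\<^sub>1)\<^sup>*\<close>. If \<open>y\<close> lies in \<open>U\<close>, then \<open>p (f x)\<close> is bounded by the standard number
  \<open>p (f y) + 1\<close>, hence finite. The condition on \<open>U\<^sub>1\<close> is what puts \<open>y\<close> into \<open>U\<close>: we have
  \<open>y = x + (- (x - y))\<close>, a sum of two elements of the symmetric set \<open>U\<^sub>1\<close>.

  The argument splits into a purely standard statement and one transfer. The lemma
  \<open>seminorm_bounded_on_translate\<close> says that, for a suitable neighbourhood \<open>V\<close> and for every
  \<open>y\<close>, the function \<open>p \<circ> f\<close> is bounded on \<open>{a \<in> U\<^sub>1. a - y \<in> V}\<close>; whether \<open>y\<close> belongs to \<open>U\<close> is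
  settled there, on the standard side, since the set is empty otherwise. In
  \<open>finite_hyperreal_star_fun_comp\<close> such a bound is transferred to the point \<open>x\<close>.
  For an (HM)-space the finite points are the pre-nearstandard ones, which gives the second
  claim, because the extensions of \<open>f\<close> and of its restriction agree on \<open>U\<^sub>1\<^sup>*\<close>.
\<close>

section \<open>Transfer\<close>

abbreviation Imp :: "'u formula \<Rightarrow> 'u formula \<Rightarrow> 'u formula" where
  "Imp \<phi> \<psi> \<equiv> Neg (Conj \<phi> (Neg \<psi>))"

abbreviation Ex_form :: "nat \<Rightarrow> 'u formula \<Rightarrow> 'u formula" where
  "Ex_form x \<phi> \<equiv> Neg (All x (Neg \<phi>))"

lemma transfer:
  assumes "nonstandard_extension N" and "\<And>s. sat (\<lambda>R. R) s \<phi>"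
  shows "sat N s \<phi>"
proof -
  have "(\<forall>s. sat (\<lambda>R. R) s \<phi>) \<longleftrightarrow> (\<forall>s. sat N s \<phi>)"
    using assms(1) unfolding nonstandard_extension_def by (rule spec)
  then show ?thesis
    using assms(2) by simp
qed

text \<open>The assignment \<open>\<lambda>i. vs ! i\<close> reads the variables \<open>0, 1, \<dots>\<close> of a formula
  off a list \<open>vs\<close>, so that transfer of a universally valid formula yields a statement about
  the given nonstandard objects \<open>vs\<close>.\<close>

lemma star_rel_mono:
  assumes N: "nonstandard_extension N" and "R \<subseteq> S" and "xs \<in> N R"
  shows "xs \<in> N S"
proof -
  let ?is = "[0..<length xs]"
  have "sat N (\<lambda>i. xs ! i) (Imp (Rel R ?is) (Rel S ?is))"
    by (rule transfer[OF N]) (use assms(2) in auto)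
  then show ?thesis
    using assms(3) by (simp add: map_nth)
qed

lemma ex1_star_singleton:
  assumes N: "nonstandard_extension N"
  shows "\<exists>!x. [x] \<in> N {[u]}"
proof (rule ex_ex1I)
  have "sat N undefined (Ex_form 0 (Rel {[u]} [0]))"
    by (rule transfer[OF N]) simp
  then show "\<exists>x. [x] \<in> N {[u]}" by simp
next
  fix x y assume "[x] \<in> N {[u]}" and "[y] \<in> N {[u]}"
  moreover have "sat N (\<lambda>i. [x, y] ! i) (Imp (Conj (Rel {[u]} [0]) (Rel {[u]} [1])) (Eq 0 1))"
    by (rule transfer[OF N]) simp
  ultimately show "x = y" by simp
qed

lemma star_elem_in_star_singleton:
  assumes "nonstandard_extension N"
  shows "[star_elem N j a] \<in> N {[j a]}"
  unfolding star_elem_def by (rule theI'[OF ex1_star_singleton[OF assms]])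

lemma star_elem_in_star_UNIV:
  assumes "nonstandard_extension N"
  shows "star_elem N j a \<in> star_set N j UNIV"
  unfolding star_set_def mem_Collect_eq
  by (rule star_rel_mono[OF assms _ star_elem_in_star_singleton[OF assms]]) auto

lemma star_set_mono:
  assumes "nonstandard_extension N" and "A \<subseteq> B"
  shows "star_set N j A \<subseteq> star_set N j B"
  unfolding star_set_def
proof (rule Collect_mono, rule impI)
  fix x assume "[x] \<in> N {[j a] |a. a \<in> A}"
  then show "[x] \<in> N {[j a] |a. a \<in> B}"
    by (rule star_rel_mono[OF assms(1), rotated]) (use assms(2) in blast)
qed

text \<open>Totality and single-valuedness of a function on \<open>A\<close> are first-order properties of its
  coded graph. The second one needs that \<open>j\<close> is injective: otherwise several arguments share
  a code.\<close>

lemma ex1_star_graph: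
  assumes N: "nonstandard_extension N" and "inj j" and "x \<in> star_set N j A"
  shows "\<exists>!y. [x, y] \<in> N {[j a, k (f a)] |a. a \<in> A}" (is "\<exists>!y. _ \<in> N ?G")
proof (rule ex_ex1I)
  have "sat N (\<lambda>i. x) (Imp (Rel {[j a] |a. a \<in> A} [0]) (Ex_form 1 (Rel ?G [0, 1])))"
    by (rule transfer[OF N]) auto
  then show "\<exists>y. [x, y] \<in> N ?G"
    using assms(3) by (simp add: star_set_def)
next
  fix y z assume "[x, y] \<in> N ?G" and "[x, z] \<in> N ?G"
  moreover have "sat N (\<lambda>i. [x, y, z] ! i)
      (Imp (Conj (Rel ?G [0, 1]) (Rel ?G [0, 2])) (Eq 1 2))"
    by (rule transfer[OF N]) (use assms(2) in \<open>auto simp: inj_eq\<close>)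
  ultimately show "y = z" by simp
qed

lemma star_fun_in_star_graph:
  assumes "nonstandard_extension N" and "inj j" and "x \<in> star_set N j A"
  shows "[x, star_fun N j k A f x] \<in> N {[j a, k (f a)] |a. a \<in> A}"
  unfolding star_fun_def by (rule theI'[OF ex1_star_graph[OF assms]])

lemma star_fun_in_star_UNIV:
  assumes N: "nonstandard_extension N" and "inj j" and "x \<in> star_set N j A"
  shows "star_fun N j k A f x \<in> star_set N k UNIV"
proof -
  let ?y = "star_fun N j k A f x"
  let ?G = "{[j a, k (f a)] |a. a \<in> A}"
  have "sat N (\<lambda>i. [x, ?y] ! i) (Imp (Rel ?G [0, 1]) (Rel {[k b] |b. b \<in> UNIV} [1]))"
    by (rule transfer[OF N]) auto
  then show ?thesis
    using star_fun_in_star_graph[OF assms, of k f] by (simp add: star_set_def)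
qed

lemma star_fun_eq_on_subset:
  assumes N: "nonstandard_extension N" and j: "inj j"
    and "A \<subseteq> B" and "\<And>a. a \<in> A \<Longrightarrow> f a = g a" and x: "x \<in> star_set N j A"
  shows "star_fun N j k B f x = star_fun N j k A g x"
proof -
  have "{[j a, k (g a)] |a. a \<in> A} \<subseteq> {[j a, k (f a)] |a. a \<in> B}"
    using assms(3,4) by force
  then have "[x, star_fun N j k A g x] \<in> N {[j a, k (f a)] |a. a \<in> B}"
    using star_rel_mono[OF N] star_fun_in_star_graph[OF N j x] by blast
  moreover have "x \<in> star_set N j B"
    using star_set_mono[OF N assms(3)] x by blast
  ultimately show ?thesis
    using ex1_star_graph[OF N j] star_fun_in_star_graph[OF N j] by blast
qed

lemma star_diff_in_star_graph:
  assumes N: "nonstandard_extension N" and "inj j"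
    and "x \<in> star_set N j UNIV" and "y \<in> star_set N j UNIV"
  shows "[x, y, star_diff N j x y] \<in> N {[j a, j b, j (a - b)] |a b. True}" (is "_ \<in> N ?D")
proof -
  have "\<exists>!z. [x, y, z] \<in> N ?D"
  proof (rule ex_ex1I)
    let ?U = "{[j a] |a. a \<in> UNIV}"
    have "sat N (\<lambda>i. [x, y] ! i)
        (Imp (Conj (Rel ?U [0]) (Rel ?U [1])) (Ex_form 2 (Rel ?D [0, 1, 2])))"
      by (rule transfer[OF N]) auto
    then show "\<exists>z. [x, y, z] \<in> N ?D"
      using assms(3,4) by (simp add: star_set_def)
  next
    fix z w assume "[x, y, z] \<in> N ?D" and "[x, y, w] \<in> N ?D"
    moreover have "sat N (\<lambda>i. [x, y, z, w] ! i)
        (Imp (Conj (Rel ?D [0, 1, 2]) (Rel ?D [0, 1, 3])) (Eq 2 3))"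
      by (rule transfer[OF N]) (use assms(2) in \<open>auto simp: inj_eq\<close>)
    ultimately show "z = w" by simp
  qed
  then show ?thesis
    unfolding star_diff_def by (rule theI')
qed

section \<open>Seminorms and uniformly continuous functions\<close>

lemma subset_if_sum_subset:
  fixes S U :: "'a::monoid_add set"
  assumes "0 \<in> S" and "{x + y |x y. x \<in> S \<and> y \<in> S} \<subseteq> U"
  shows "S \<subseteq> U"
proof
  fix x assume "x \<in> S"
  then have "x + 0 \<in> {x + y |x y. x \<in> S \<and> y \<in> S}"
    using assms(1) by blast
  then show "x \<in> U"
    using assms(2) by auto
qed

lemma seminorm_zero:
  assumes "seminorm p"
  shows "p 0 = 0"
proof -
  have "p (0 *\<^sub>R 0) = \<bar>0\<bar> * p 0"
    using assms unfolding seminorm_def by blast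
  then show ?thesis by simp
qed

lemma seminorm_nonneg:
  assumes "seminorm p"
  shows "0 \<le> p x"
proof -
  have "p (- x) = p x"
    using assms unfolding seminorm_def by (metis abs_minus_cancel abs_one mult_1 scaleR_minus1_left)
  moreover have "p (x + - x) \<le> p x + p (- x)"
    using assms unfolding seminorm_def by blast
  ultimately show ?thesis
    using seminorm_zero[OF assms] by simp
qed

text \<open>The preimage under \<open>f\<close> of the entourage \<open>{(u, v). p (v - u) < 1}\<close> is an entourage on \<open>U\<close>,
  and entourages are generated by conditions on differences.\<close>

lemma uniformly_continuous_on_seminorm_bound:
  fixes f :: "'e::locally_convex_space \<Rightarrow> 'f::locally_convex_space"
  assumes "uniformly_continuous_on U f" and p: "seminorm p" and "continuous_on UNIV p"
  obtains W where "open W" and "0 \<in> W"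
    and "\<And>a b. a \<in> U \<Longrightarrow> b \<in> U \<Longrightarrow> a - b \<in> W \<Longrightarrow> p (f a) \<le> p (f b) + 1"
proof -
  let ?B = "{v. p v < 1}"
  have "open ?B"
    using assms(3) by (intro open_Collect_less continuous_on_const) auto
  moreover have "0 \<in> ?B"
    using seminorm_zero[OF p] by simp
  ultimately have "eventually (\<lambda>v. v \<in> ?B) (nhds 0)"
    by (rule eventually_nhds_in_open)
  then have "eventually (\<lambda>(u, v). v - u \<in> ?B) uniformity"
    unfolding cauchy_seq_finset_iff_vanishing by (force simp: eventually_filtercomap)
  then have "eventually (\<lambda>(a, b). a \<in> U \<longrightarrow> b \<in> U \<longrightarrow> f b - f a \<in> ?B) uniformity"
    using uniformly_continuous_onD[OF assms(1)] by fastforce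
  then obtain Q where Q: "eventually Q (nhds 0)"
    and Q_imp: "\<And>a b. Q (b - a) \<Longrightarrow> a \<in> U \<Longrightarrow> b \<in> U \<Longrightarrow> f b - f a \<in> ?B"
    unfolding cauchy_seq_finset_iff_vanishing eventually_filtercomap by fastforce
  obtain W where W: "open W" "0 \<in> W" "\<And>w. w \<in> W \<Longrightarrow> Q w"
    using Q unfolding eventually_nhds by blast
  show thesis
  proof (rule that[OF W(1,2)])
    fix a b assume "a \<in> U" "b \<in> U" "a - b \<in> W"
    then have "p (f a - f b) < 1"
      using Q_imp W(3) by blast
    moreover have "p (f b + (f a - f b)) \<le> p (f b) + p (f a - f b)"
      using p unfolding seminorm_def by blast
    ultimately show "p (f a) \<le> p (f b) + 1" by simp
  qed
qed

text \<open>Choose \<open>V\<close> inside \<open>S\<close>. If some \<open>a \<in> S\<close> has \<open>a - y \<in> V\<close>, then \<open>y = a + (- (a - y))\<close> lies in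
  \<open>S + S \<subseteq> U\<close>, so uniform continuity on \<open>U\<close> may be applied to \<open>a\<close> and \<open>y\<close>. Otherwise the bound
  holds vacuously.\<close>

lemma seminorm_bounded_on_translate:
  fixes f :: "'e::locally_convex_space \<Rightarrow> 'f::locally_convex_space"
  assumes "uniformly_continuous_on U f" and p: "seminorm p" and "continuous_on UNIV p"
    and "open S" and "0 \<in> S" and symm: "uminus ` S = S"
    and sum: "{x + y |x y. x \<in> S \<and> y \<in> S} \<subseteq> U"
  obtains V where "0 \<in> interior V"
    and "\<And>y. \<exists>M. \<forall>a\<in>S. a - y \<in> V \<longrightarrow> \<bar>p (f a)\<bar> \<le> M"
proof -
  obtain W where W: "open W" "0 \<in> W"
    and bound: "\<And>a b. a \<in> U \<Longrightarrow> b \<in> U \<Longrightarrow> a - b \<in> W \<Longrightarrow> p (f a) \<le> p (f b) + 1"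
    using uniformly_continuous_on_seminorm_bound[OF assms(1-3)] by blast
  have S_subset: "S \<subseteq> U"
    by (rule subset_if_sum_subset[OF \<open>0 \<in> S\<close> sum])
  show thesis
  proof
    show "0 \<in> interior (W \<inter> S)"
      using W assms(4,5) by (simp add: interior_open open_Int)
    show "\<exists>M. \<forall>a\<in>S. a - y \<in> W \<inter> S \<longrightarrow> \<bar>p (f a)\<bar> \<le> M" for y
    proof (intro exI ballI impI)
      fix a assume a: "a \<in> S" "a - y \<in> W \<inter> S"
      then have "- (a - y) \<in> S"
        using symm by blast
      then have "a + - (a - y) \<in> U"
        using sum a(1) by blast
      then have "p (f a) \<le> p (f y) + 1"
        using bound[of a y] a S_subset by auto
      then show "\<bar>p (f a)\<bar> \<le> p (f y) + 1"
        using seminorm_nonneg[OF p, of "f a"] by simp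
    qed
  qed
qed

section \<open>Finiteness of the values\<close>

text \<open>The standard bound becomes a first-order sentence once the fixed point \<open>y\<close> and the number
  \<open>M\<close> are named by the singleton relations \<open>{[jE y]}\<close> and \<open>{[jR M]}\<close>. Its transfer bounds the
  value at \<open>x\<close> by the extension of the standard real \<open>M\<close>, which is what finiteness means.\<close>

lemma finite_hyperreal_star_fun_comp:
  fixes jE :: "'e::ab_group_add \<Rightarrow> 'u" and f :: "'e \<Rightarrow> 'f" and p :: "'f \<Rightarrow> real"
  assumes N: "nonstandard_extension N" and jE: "inj jE" and jF: "inj jF" and jR: "inj jR"
    and x: "x \<in> star_set N jE S"
    and diff: "star_diff N jE x (star_elem N jE y) \<in> star_set N jE V"
    and bound: "\<And>a. a \<in> S \<Longrightarrow> a - y \<in> V \<Longrightarrow> \<bar>p (f a)\<bar> \<le> M"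
  shows "finite_hyperreal N jR (star_fun N jF jR UNIV p (star_fun N jE jF S f x))"
proof -
  let ?y = "star_elem N jE y" and ?M = "star_elem N jR M"
  let ?d = "star_diff N jE x ?y"
  let ?w = "star_fun N jE jF S f x"
  let ?r = "star_fun N jF jR UNIV p ?w"
  let ?S = "{[jE a] |a. a \<in> S}" and ?V = "{[jE a] |a. a \<in> V}"
  let ?D = "{[jE a, jE b, jE (a - b)] |a b. True}"
  let ?F = "{[jE a, jF (f a)] |a. a \<in> S}" and ?P = "{[jF b, jR (p b)] |b. b \<in> UNIV}"
  let ?L = "{[jR a, jR b] |a b. \<bar>a\<bar> \<le> b}"
  have w: "?w \<in> star_set N jF UNIV"
    by (rule star_fun_in_star_UNIV[OF N jE x])
  have xU: "x \<in> star_set N jE UNIV"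
    using star_set_mono[OF N subset_UNIV] x by blast
  have hyps: "[x] \<in> N ?S" "[?y] \<in> N {[jE y]}" "[?M] \<in> N {[jR M]}" "[x, ?y, ?d] \<in> N ?D"
    "[?d] \<in> N ?V" "[x, ?w] \<in> N ?F" "[?w, ?r] \<in> N ?P"
    using x diff star_elem_in_star_singleton[OF N]
      star_diff_in_star_graph[OF N jE xU star_elem_in_star_UNIV[OF N]]
      star_fun_in_star_graph[OF N jE x] star_fun_in_star_graph[OF N jF w]
    by (simp_all add: star_set_def)
  have "sat N (\<lambda>i. [x, ?y, ?d, ?w, ?r, ?M] ! i)
    (Imp (Conj (Rel ?S [0]) (Conj (Rel {[jE y]} [1]) (Conj (Rel {[jR M]} [5])
      (Conj (Rel ?D [0, 1, 2]) (Conj (Rel ?V [2]) (Conj (Rel ?F [0, 3]) (Rel ?P [3, 4])))))))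
      (Rel ?L [4, 5]))"
    by (rule transfer[OF N]) (use jE jF jR bound in \<open>auto simp: inj_eq\<close>)
  then have "[?r, ?M] \<in> N ?L"
    using hyps by simp
  moreover have "?r \<in> star_set N jR UNIV"
    by (rule star_fun_in_star_UNIV[OF N jF w])
  ultimately show ?thesis
    unfolding finite_hyperreal_def by blast
qed

lemma star_fun_pns_points_subset_fin_points:
  fixes f :: "'e::locally_convex_space \<Rightarrow> 'f::locally_convex_space"
  assumes N: "nonstandard_extension N" and jE: "inj jE" and jF: "inj jF" and jR: "inj jR"
    and "uniformly_continuous_on U f" and "open S" and "0 \<in> S" and "uminus ` S = S"
    and "{x + y |x y. x \<in> S \<and> y \<in> S} \<subseteq> U"
  shows "star_fun N jE jF S f ` (star_set N jE S \<inter> pns_points N jE) \<subseteq> fin_points N jF jR"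
proof (rule image_subsetI)
  fix x assume x: "x \<in> star_set N jE S \<inter> pns_points N jE"
  let ?w = "star_fun N jE jF S f x"
  have "finite_hyperreal N jR (star_fun N jF jR UNIV p ?w)"
    if p: "seminorm p" "continuous_on UNIV p" for p
  proof -
    obtain V where V: "0 \<in> interior V"
      and bound: "\<And>y. \<exists>M. \<forall>a\<in>S. a - y \<in> V \<longrightarrow> \<bar>p (f a)\<bar> \<le> M"
      using seminorm_bounded_on_translate[OF assms(5) p assms(6-9)] by blast
    obtain y where y: "star_diff N jE x (star_elem N jE y) \<in> star_set N jE V"
      using x V unfolding pns_points_def by blast
    obtain M where "\<forall>a\<in>S. a - y \<in> V \<longrightarrow> \<bar>p (f a)\<bar> \<le> M"
      using bound by blast
    then show ?thesis
      using finite_hyperreal_star_fun_comp[OF N jE jF jR _ y] x by blast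
  qed
  moreover have "?w \<in> star_set N jF UNIV"
    using star_fun_in_star_UNIV[OF N jE] x by blast
  ultimately show "?w \<in> fin_points N jF jR"
    unfolding fin_points_def by blast
qed

theorem lemma4p3:
  fixes N :: "'u list set \<Rightarrow> 'v list set"
    and jE :: "'e::locally_convex_space \<Rightarrow> 'u"
    and jF :: "'f::locally_convex_space \<Rightarrow> 'u"
    and jR :: "real \<Rightarrow> 'u"
    and \<kappa> :: "'k rel"
    and f :: "'e \<Rightarrow> 'f"
    and U U\<^sub>1 :: "'e set"
  assumes "nonstandard_extension N"
    and "inj jE" and "inj jF" and "inj jR"
    and "Card_order \<kappa>" and "natLeq <o \<kappa>" and "saturated \<kappa> N"
    and "\<exists>\<B> :: 'e set set. nbhd_base_0 \<B> \<and> |\<B>| <o \<kappa>"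
    and "\<exists>\<B> :: 'f set set. nbhd_base_0 \<B> \<and> |\<B>| <o \<kappa>"
    and "open U" and "0 \<in> U" and "uniformly_continuous_on U f"
    and "open U\<^sub>1" and "0 \<in> U\<^sub>1" and "uminus ` U\<^sub>1 = U\<^sub>1"
    and "{x + y |x y. x \<in> U\<^sub>1 \<and> y \<in> U\<^sub>1} \<subseteq> U"
  shows "star_fun N jE jF U f ` (star_set N jE U\<^sub>1 \<inter> pns_points N jE) \<subseteq> fin_points N jF jR
    \<and> (HM_space N jE jR \<longrightarrow> finite_function N jE jF jR U\<^sub>1 (restrict f U\<^sub>1))"
proof -
  have subset: "U\<^sub>1 \<subseteq> U"
    by (rule subset_if_sum_subset[OF assms(14,16)])
  have fin: "star_fun N jE jF U\<^sub>1 f ` (star_set N jE U\<^sub>1 \<inter> pns_points N jE) \<subseteq> fin_points N jF jR"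
    by (rule star_fun_pns_points_subset_fin_points[OF assms(1-4,12-16)])
  have on_U: "star_fun N jE jF U f x = star_fun N jE jF U\<^sub>1 f x"
    if "x \<in> star_set N jE U\<^sub>1" for x
    by (rule star_fun_eq_on_subset[OF assms(1,2) subset _ that]) simp
  have on_U1: "star_fun N jE jF U\<^sub>1 (restrict f U\<^sub>1) x = star_fun N jE jF U\<^sub>1 f x"
    if "x \<in> star_set N jE U\<^sub>1" for x
    by (rule star_fun_eq_on_subset[OF assms(1,2) subset_refl _ that]) simp
  show ?thesis
    using fin on_U on_U1 unfolding HM_space_def finite_function_def
    by (auto simp: image_subset_iff)
qed

end
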